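(* Let $n\ge1$ and $N\ge1$ be integers, let $a<b$ be real numbers, let $p$ be a real polynomial of degree $n$ with leading coefficient $1/n!$, and let $1\le r,s\le\infty$ with $1/r+1/s=1$. Let $f:[a,b]\to\mathbb{R}$ be such that $f^{(n-1)}$ is absolutely continuous and $f^{(n)}\in L^s([a,b])$. Then $$\left|E_{(a,b)}^N(p,f)\right|\le \frac{(b-a)^{n+1/r}}{N^{n}}\,\|p\|_r\,\|f^{(n)}\|_s.$$
   Context: For an interval $[\alpha,\beta]$ the error term is $$E_{(\alpha,\beta)}(p,f)=(-1)^n(\beta-\alpha)^{n+1}\int_0^1 p(x)f^{(n)}\big(\alpha+(\beta-\alpha)x\big)\,dx,$$ and with $h=(b-a)/N$ the composite error term is $$E_{(a,b)}^N(p,f)=\sum_{k=0}^{N-1}E_{(a+kh,\,a+(k+1)h)}(p,f).$$ The norms are $\|p\|_r=\left(\int_0^1|p(x)|^r\,dx\right)^{1/r}$ for $r<\infty$, $\|p\|_\infty=\max_{x\in[0,1]}|p(x)|$, $\|f^{(n)}\|_s=\left(\int_a^b|f^{(n)}(x)|^s\,dx\right)^{1/s}$ for $s<\infty$, and $\|f^{(n)}\|_\infty$ is the (essential) supremum of $|f^{(n)}|$ on $[a,b]$. The convention $1/\infty=0$ is used. *)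

theory Defs
  imports
    "HOL-Analysis.Analysis"
    "HOL-Probability.Essential_Supremum"
    "HOL-Computational_Algebra.Polynomial"
begin

text \<open>
  Derivatives of a function on \<^term>\<open>D\<close> are taken within \<^term>\<open>D\<close>, so they are one-sided at the end
  points of an interval and ignore the values of \<^term>\<open>f\<close> outside \<^term>\<open>D\<close>. Where a derivative does not
  exist its value is some unspecified real; for the \<open>n\<close>-th derivative of a function with absolutely
  continuous \<open>(n-1)\<close>-st derivative, this concerns only a null set.
\<close>

primrec nth_deriv_on :: "real set \<Rightarrow> nat \<Rightarrow> (real \<Rightarrow> real) \<Rightarrow> real \<Rightarrow> real" where
  "nth_deriv_on D 0 f = f"
| "nth_deriv_on D (Suc k) f = (\<lambda>x. vector_derivative (nth_deriv_on D k f) (at x within D))"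

text \<open>
  The usual epsilon-delta definition. A division is a finite family of compact intervals with
  disjoint interiors; \<^term>\<open>Inf K\<close> and \<^term>\<open>Sup K\<close> are the end points of the interval \<^term>\<open>K\<close>.
\<close>

definition absolutely_continuous_on :: "real set \<Rightarrow> (real \<Rightarrow> real) \<Rightarrow> bool" where
  "absolutely_continuous_on D g \<longleftrightarrow>
     (\<forall>\<epsilon>>0. \<exists>\<delta>>0. \<forall>\<D>. \<D> division_of \<Union>\<D> \<and> \<Union>\<D> \<subseteq> D \<and> (\<Sum>K\<in>\<D>. Sup K - Inf K) < \<delta> \<longrightarrow>
        (\<Sum>K\<in>\<D>. \<bar>g (Sup K) - g (Inf K)\<bar>) < \<epsilon>)"

definition in_Lp :: "ereal \<Rightarrow> 'a measure \<Rightarrow> ('a \<Rightarrow> real) \<Rightarrow> bool" where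
  "in_Lp s M g \<longleftrightarrow> g \<in> borel_measurable M \<and>
     (if s = \<infinity> then esssup M (\<lambda>x. ereal \<bar>g x\<bar>) < \<infinity>
      else integrable M (\<lambda>x. \<bar>g x\<bar> powr real_of_ereal s))"

definition Lp_norm :: "ereal \<Rightarrow> 'a measure \<Rightarrow> ('a \<Rightarrow> real) \<Rightarrow> real" where
  "Lp_norm s M g =
     (if s = \<infinity> then real_of_ereal (esssup M (\<lambda>x. ereal \<bar>g x\<bar>))
      else (LINT x|M. \<bar>g x\<bar> powr real_of_ereal s) powr (1 / real_of_ereal s))"

text \<open>The supremum below is a maximum, because \<^term>\<open>poly p\<close> is continuous on a compact interval.\<close>

definition poly_norm :: "ereal \<Rightarrow> real poly \<Rightarrow> real" where
  "poly_norm r p =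
     (if r = \<infinity> then (SUP x\<in>{0..1}. \<bar>poly p x\<bar>)
      else (LINT x|lebesgue_on {0..1}. \<bar>poly p x\<bar> powr real_of_ereal r) powr (1 / real_of_ereal r))"

text \<open>
  \<^term>\<open>D\<close> is the domain of \<^term>\<open>f\<close>, and \<open>[\<alpha>, \<beta>]\<close> a subinterval of it.
\<close>

definition error_term ::
  "real set \<Rightarrow> nat \<Rightarrow> real \<Rightarrow> real \<Rightarrow> real poly \<Rightarrow> (real \<Rightarrow> real) \<Rightarrow> real" where
  "error_term D n \<alpha> \<beta> p f =
     (-1) ^ n * (\<beta> - \<alpha>) ^ (n + 1) *
       (LINT x|lebesgue_on {0..1}. poly p x * nth_deriv_on D n f (\<alpha> + (\<beta> - \<alpha>) * x))"

definition composite_error ::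
  "nat \<Rightarrow> nat \<Rightarrow> real \<Rightarrow> real \<Rightarrow> real poly \<Rightarrow> (real \<Rightarrow> real) \<Rightarrow> real" where
  "composite_error n N a b p f =
     (let h = (b - a) / real N
      in \<Sum>k<N. error_term {a..b} n (a + real k * h) (a + real (k + 1) * h) p f)"

end

(* On the k-th subinterval substitute x = (t - a) / h - k, so that the composite
   error becomes (-1)^n h^n times the integral over [a, b] of P g, where g is the n-th derivative of f
   and P(t) = p(frac((t - a) / h)) repeats p on each subinterval. A single application of Hoelder's
   inequality on [a, b] gives the bound, because the L^r norm of P is (b - a)^(1/r) times that of p. *)

theory Submission
  imports Defs
begin

section \<open>Conjugate exponents and Hoelder's inequality\<close>

text \<open>Since \<open>1 / \<infinity> = 0\<close> in the extended reals, an infinite exponent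
  forces its partner to be 1. Two real exponents both exceed 1, because the reciprocal of a real
  number that is at least 1 is never 0.\<close>

lemma conjugate_exponent_cases:
  fixes r s :: ereal
  assumes "1 \<le> r" and "1 \<le> s" and "1 / r + 1 / s = 1"
  obtains (left_inf) "r = \<infinity>" "s = 1"
    | (right_inf) "r = 1" "s = \<infinity>"
    | (finite) r' s' where "r = ereal r'" "s = ereal s'" "1 < r'" "1 < s'" "1 / r' + 1 / s' = 1"
proof (cases r)
  case r: (real r')
  show ?thesis
  proof (cases s)
    case s: (real s')
    have ge: "1 \<le> r'" "1 \<le> s'" using assms r s by (auto simp: one_ereal_def)
    have eq: "1 / r' + 1 / s' = 1"
      using assms(3) r s ge by (simp add: one_ereal_def)
    have "r' \<noteq> 1" "s' \<noteq> 1" using eq ge by auto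
    then show ?thesis using finite r s ge eq by auto
  next
    case PInf
    have "1 \<le> r'" using assms r by (auto simp: one_ereal_def)
    then show ?thesis
      using right_inf assms(3) r PInf by (simp add: one_ereal_def)
  qed (use assms in auto)
next
  case PInf
  show ?thesis
  proof (cases s)
    case s: (real s')
    have "1 \<le> s'" using assms s by (auto simp: one_ereal_def)
    then show ?thesis
      using left_inf assms(3) s PInf by (simp add: one_ereal_def)
  qed (use assms PInf in auto)
qed (use assms in auto)

text \<open>For \<open>s = \<infinity>\<close> on a null space the essential supremum is infinite:
  negative for a measurable function, positive otherwise; \<open>real_of_ereal\<close> maps both
  values to 0. On any other space it dominates the essential supremum of the zero function.\<close>

lemma Lp_norm_nonneg: "0 \<le> Lp_norm s M g"
proof -
  define e where "e = esssup M (\<lambda>x. ereal \<bar>g x\<bar>)"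
  have "0 \<le> real_of_ereal e"
  proof (cases "emeasure M (space M) = 0")
    case True
    then show ?thesis
      using esssup_zero_space[OF True, of "\<lambda>x. ereal \<bar>g x\<bar>"]
        esssup_non_measurable[of "\<lambda>x. ereal \<bar>g x\<bar>" M]
      by (cases "(\<lambda>x. ereal \<bar>g x\<bar>) \<in> borel_measurable M") (auto simp: e_def top_ereal_def)
  next
    case False
    have "0 = esssup M (\<lambda>x. 0::ereal)"
      using esssup_const[OF False] by simp
    also have "\<dots> \<le> e"
      unfolding e_def by (rule esssup_mono) auto
    finally show ?thesis by (rule real_of_ereal_pos)
  qed
  then show ?thesis by (simp add: Lp_norm_def e_def)
qed

lemma Holder_L1_Linf:
  fixes u v :: "'a \<Rightarrow> real"
  assumes "in_Lp 1 M u" and "in_Lp \<infinity> M v"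
  shows "integrable M (\<lambda>x. u x * v x)"
    and "\<bar>LINT x|M. u x * v x\<bar> \<le> Lp_norm 1 M u * Lp_norm \<infinity> M v"
proof -
  have [measurable]: "u \<in> borel_measurable M" "v \<in> borel_measurable M"
    using assms by (auto simp: in_Lp_def)
  have u: "integrable M (\<lambda>x. \<bar>u x\<bar>)"
    using assms(1) by (simp add: in_Lp_def)
  define C where "C = Lp_norm \<infinity> M v"
  have le: "AE x in M. \<bar>v x\<bar> \<le> C"
    using esssup_AE[where M = M and f = "\<lambda>x. ereal \<bar>v x\<bar>"]
  proof eventually_elim
    case (elim x)
    \<comment> \<open>Finiteness excludes the value \<open>\<infinity>\<close>, which
      \<open>real_of_ereal\<close> would turn into the false bound 0.\<close>
    moreover have "esssup M (\<lambda>x. ereal \<bar>v x\<bar>) < \<infinity>"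
      using assms(2) by (simp add: in_Lp_def)
    ultimately show ?case
      by (cases "esssup M (\<lambda>x. ereal \<bar>v x\<bar>)") (auto simp: C_def Lp_norm_def)
  qed
  have le': "AE x in M. \<bar>u x * v x\<bar> \<le> \<bar>u x\<bar> * C"
    using le by eventually_elim (auto simp: abs_mult intro: mult_left_mono)
  show int: "integrable M (\<lambda>x. u x * v x)"
    by (rule Bochner_Integration.integrable_bound[where f = "\<lambda>x. \<bar>u x\<bar> * C"])
      (use u le' in \<open>auto elim!: eventually_mono\<close>)
  have "\<bar>LINT x|M. u x * v x\<bar> \<le> (LINT x|M. \<bar>u x * v x\<bar>)"
    using integral_abs_bound .
  also have "\<dots> \<le> (LINT x|M. \<bar>u x\<bar> * C)"
    by (rule integral_mono_AE) (use u int le' in auto)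
  finally show "\<bar>LINT x|M. u x * v x\<bar> \<le> Lp_norm 1 M u * Lp_norm \<infinity> M v"
    by (simp add: C_def Lp_norm_def)
qed

text \<open>Young's inequality dominates \<open>u x * v x\<close> by an integrable function. Applied
  again after dividing \<open>u\<close> and \<open>v\<close> by their norms \<open>\<alpha>\<close>
  and \<open>\<beta>\<close>, it yields the product bound.\<close>

lemma Holder_finite:
  fixes u v :: "'a \<Rightarrow> real"
  assumes "in_Lp (ereal r) M u" and "in_Lp (ereal s) M v"
    and rs: "1 < r" "1 < s" "1 / r + 1 / s = 1"
  shows "integrable M (\<lambda>x. u x * v x)"
    and "\<bar>LINT x|M. u x * v x\<bar> \<le> Lp_norm (ereal r) M u * Lp_norm (ereal s) M v"
proof -
  have [measurable]: "u \<in> borel_measurable M" "v \<in> borel_measurable M"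
    and u: "integrable M (\<lambda>x. \<bar>u x\<bar> powr r)" and v: "integrable M (\<lambda>x. \<bar>v x\<bar> powr s)"
    using assms by (auto simp: in_Lp_def)
  have bound: "\<bar>u x * v x\<bar> \<le> \<bar>u x\<bar> powr r / r + \<bar>v x\<bar> powr s / s" for x
    using Youngs_inequality[OF rs, of "\<bar>u x\<bar>" "\<bar>v x\<bar>"] by (simp add: abs_mult)
  show int: "integrable M (\<lambda>x. u x * v x)"
    by (rule Bochner_Integration.integrable_bound[where f = "\<lambda>x. \<bar>u x\<bar> powr r / r + \<bar>v x\<bar> powr s / s"])
      (use u v bound rs in \<open>auto intro!: AE_I2 order_trans[OF bound]\<close>)
  define A where "A = (LINT x|M. \<bar>u x\<bar> powr r)"
  define B where "B = (LINT x|M. \<bar>v x\<bar> powr s)"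
  define \<alpha> where "\<alpha> = A powr (1 / r)"
  define \<beta> where "\<beta> = B powr (1 / s)"
  have "0 \<le> A" "0 \<le> B" by (auto simp: A_def B_def)
  show "\<bar>LINT x|M. u x * v x\<bar> \<le> Lp_norm (ereal r) M u * Lp_norm (ereal s) M v"
  \<comment> \<open>A zero norm cannot be divided by; in that case one factor, hence the product,
    vanishes almost everywhere.\<close>
  proof (cases "A = 0 \<or> B = 0")
    case True
    have "A = 0 \<Longrightarrow> AE x in M. u x = 0" "B = 0 \<Longrightarrow> AE x in M. v x = 0"
      using integral_nonneg_eq_0_iff_AE[OF u] integral_nonneg_eq_0_iff_AE[OF v]
      by (simp_all add: A_def B_def)
    with True have "AE x in M. u x * v x = 0" by auto
    then have "(LINT x|M. u x * v x) = 0" by (rule integral_eq_zero_AE)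
    then show ?thesis by (simp add: Lp_norm_def)
  next
    case False
    then have pos: "0 < A" "0 < B" "0 < \<alpha>" "0 < \<beta>"
      using \<open>0 \<le> A\<close> \<open>0 \<le> B\<close> by (auto simp: \<alpha>_def \<beta>_def)
    have pw: "\<alpha> powr r = A" "\<beta> powr s = B"
      using pos rs by (simp_all add: \<alpha>_def \<beta>_def powr_powr)
    have scaled: "\<bar>u x * v x\<bar> / (\<alpha> * \<beta>) \<le> \<bar>u x\<bar> powr r / (r * A) + \<bar>v x\<bar> powr s / (s * B)" for x
      using Youngs_inequality[OF rs, of "\<bar>u x\<bar> / \<alpha>" "\<bar>v x\<bar> / \<beta>"] pos pw
      by (simp add: abs_mult powr_divide mult.commute)
    have "(LINT x|M. \<bar>u x * v x\<bar> / (\<alpha> * \<beta>))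
        \<le> (LINT x|M. \<bar>u x\<bar> powr r / (r * A) + \<bar>v x\<bar> powr s / (s * B))"
      by (rule integral_mono) (use int u v scaled in auto)
    \<comment> \<open>By the choice of \<open>A\<close> and \<open>B\<close> the two terms integrate
      to \<open>1 / r\<close> and \<open>1 / s\<close>.\<close>
    also have "\<dots> = 1"
      using u v pos rs by (simp add: A_def[symmetric] B_def[symmetric])
    finally have "(LINT x|M. \<bar>u x * v x\<bar>) \<le> \<alpha> * \<beta>"
      using pos by (simp add: divide_le_eq)
    then have "\<bar>LINT x|M. u x * v x\<bar> \<le> \<alpha> * \<beta>"
      using integral_abs_bound[of M "\<lambda>x. u x * v x"] by linarith
    then show ?thesis by (simp add: Lp_norm_def \<alpha>_def \<beta>_def A_def B_def)
  qed
qed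

text \<open>The case \<open>r = \<infinity>\<close> is the L1-Linf bound with the factors exchanged.
  Integrability is part of the conclusion because cutting the integral over \<open>[a, b]\<close>
  into blocks relies on it.\<close>

lemma Holder_inequality:
  fixes u v :: "'a \<Rightarrow> real"
  assumes "1 \<le> r" and "1 \<le> s" and "1 / r + 1 / s = 1"
    and u: "in_Lp r M u" and v: "in_Lp s M v"
  shows "integrable M (\<lambda>x. u x * v x)"
    and "\<bar>LINT x|M. u x * v x\<bar> \<le> Lp_norm r M u * Lp_norm s M v"
proof -
  from assms(1-3)
  have "integrable M (\<lambda>x. u x * v x) \<and> \<bar>LINT x|M. u x * v x\<bar> \<le> Lp_norm r M u * Lp_norm s M v"
  proof (cases rule: conjugate_exponent_cases)
    case left_inf
    then show ?thesis using Holder_L1_Linf[of M v u] u v by (simp add: mult.commute)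
  next
    case right_inf
    then show ?thesis using Holder_L1_Linf[of M u v] u v by simp
  next
    case (finite r' s')
    then show ?thesis using Holder_finite[of r' M u s' v] u v by simp
  qed
  then show "integrable M (\<lambda>x. u x * v x)"
    and "\<bar>LINT x|M. u x * v x\<bar> \<le> Lp_norm r M u * Lp_norm s M v" by auto
qed

section \<open>Integrals over equal blocks\<close>

lemma integral_lebesgue_on_affine:
  fixes F :: "real \<Rightarrow> real"
  assumes "0 < h"
  shows "(LINT x|lebesgue_on {c..c + h}. F x) = h * (LINT x|lebesgue_on {0..1}. F (c + h * x))"
proof -
  \<comment> \<open>The substitution is carried out on the whole line, so the cut-off to the block
    has to become the cut-off to the unit interval.\<close>
  have "indicator {c..c + h} (c + h * x) = (indicator {0..1} x :: real)" for x
    using assms by (auto simp: indicator_def zero_le_mult_iff)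
  then show ?thesis
    using lebesgue_integral_real_affine[of h "\<lambda>x. indicator {c..c + h} x *\<^sub>R F x" c] assms
    by (simp add: integral_restrict_space)
qed

text \<open>Induction on \<open>N\<close> splits off the last block; integrability makes the
  integral additive over adjacent intervals. For \<open>N = 0\<close> the domain is the single point
  \<open>a\<close>, a null set.\<close>

lemma integral_equal_blocks:
  fixes F :: "real \<Rightarrow> real"
  assumes "0 < h" and "integrable (lebesgue_on {a..a + real N * h}) F"
  shows "(LINT x|lebesgue_on {a..a + real N * h}. F x)
    = h * (\<Sum>k<N. LINT x|lebesgue_on {0..1}. F (a + real k * h + h * x))"
  using assms(2)
proof (induction N)
  case 0
  have "{a} \<in> null_sets lebesgue" by simp
  from has_bochner_integral_null[OF this, of F] show ?case
    by (simp add: has_bochner_integral_iff)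
next
  case (Suc N)
  have eq: "a + real (Suc N) * h = a + real N * h + h" by (simp add: algebra_simps)
  have le: "a \<le> a + real N * h" "a + real N * h \<le> a + real (Suc N) * h"
    using assms(1) by (auto simp: algebra_simps)
  have "integrable (lebesgue_on {a..a + real N * h}) F"
    by (rule integrable_subinterval[OF Suc.prems]) (use le in auto)
  then show ?case
    using integral_combine[OF Suc.prems le] Suc.IH
      integral_lebesgue_on_affine[OF assms(1), of "a + real N * h" F]
    by (simp add: eq algebra_simps)
qed

text \<open>Lebesgue measure is complete, so changing a function on a null set preserves
  measurability. Hence the two cut-off functions are both measurable, or neither is and both
  integrals take the default value 0.\<close>

lemma integral_lebesgue_on_cong_AE:
  fixes u v :: "real \<Rightarrow> real"
  assumes "S \<in> sets lebesgue" and "AE x in lebesgue. x \<in> S \<longrightarrow> u x = v x"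
  shows "(LINT x|lebesgue_on S. u x) = (LINT x|lebesgue_on S. v x)"
proof -
  define u' where "u' = (\<lambda>x. indicator S x *\<^sub>R u x)"
  define v' where "v' = (\<lambda>x. indicator S x *\<^sub>R v x)"
  have uv: "AE x in lebesgue. u' x = v' x"
    using assms(2) by eventually_elim (auto simp: u'_def v'_def indicator_def)
  have vu: "AE x in lebesgue. v' x = u' x"
    using uv by eventually_elim simp
  have meas: "u' \<in> borel_measurable lebesgue \<longleftrightarrow> v' \<in> borel_measurable lebesgue"
    using borel_measurable_AE[OF _ uv] borel_measurable_AE[OF _ vu] by blast
  have "integral\<^sup>L lebesgue u' = integral\<^sup>L lebesgue v'"
  proof (cases "u' \<in> borel_measurable lebesgue")
    case True
    then show ?thesis using meas uv by (intro integral_cong_AE) auto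
  next
    case False
    then have "\<not> integrable lebesgue u'" "\<not> integrable lebesgue v'"
      using meas by auto
    then show ?thesis by (simp add: not_integrable_integral_eq)
  qed
  then show ?thesis
    using assms(1) by (simp add: integral_restrict_space u'_def v'_def)
qed

text \<open>On the block with index \<open>k\<close> the substitution turns the argument of
  \<open>frac\<close> into \<open>k + x\<close>, so the periodic factor becomes
  \<open>q x\<close>.\<close>

lemma integral_periodic_factor:
  fixes q G :: "real \<Rightarrow> real"
  assumes "0 < h"
    and "integrable (lebesgue_on {a..a + real N * h}) (\<lambda>t. q (frac ((t - a) / h)) * G t)"
  shows "(LINT t|lebesgue_on {a..a + real N * h}. q (frac ((t - a) / h)) * G t)
    = h * (\<Sum>k<N. LINT x|lebesgue_on {0..1}. q x * G (a + real k * h + h * x))"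
proof -
  \<comment> \<open>The right end point is excluded: at \<open>x = 1\<close> the fractional part is
    0, not 1. A single point does not affect the integral.\<close>
  have frac: "frac ((a + real k * h + h * x - a) / h) = x" if "x \<in> {0..1}" "x \<noteq> 1" for k x
  proof -
    have "(a + real k * h + h * x - a) / h = of_int (int k) + x"
      using assms(1) by (simp add: field_simps)
    then show ?thesis using that by (simp add: frac_unique_iff)
  qed
  have "AE x in lebesgue. x \<noteq> (1::real)"
    using AE_lborel_singleton by (rule AE_completion)
  then have "AE x in lebesgue. x \<in> {0..1} \<longrightarrow>
      q (frac ((a + real k * h + h * x - a) / h)) * G (a + real k * h + h * x)
      = q x * G (a + real k * h + h * x)" for k
  proof eventually_elim
    case (elim x)
    then show ?case using frac[of x k] by (intro impI) (simp only: simp_thms)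
  qed
  then have "(LINT x|lebesgue_on {0..1}. q (frac ((a + real k * h + h * x - a) / h)) * G (a + real k * h + h * x))
      = (LINT x|lebesgue_on {0..1}. q x * G (a + real k * h + h * x))" for k
    by (intro integral_lebesgue_on_cong_AE) auto
  then show ?thesis
    using integral_equal_blocks[OF assms] by simp
qed

section \<open>Norms of the periodic repetition of a polynomial\<close>

text \<open>A real \<open>SUP\<close> is an upper bound only once the set is known to be bounded
  above; compactness of the image supplies this.\<close>

lemma abs_poly_le_poly_norm_infinity:
  assumes "0 \<le> x" and "x \<le> 1"
  shows "\<bar>poly p x\<bar> \<le> poly_norm \<infinity> p"
proof -
  have "compact ((\<lambda>x. \<bar>poly p x\<bar>) ` {0..1})"
    by (intro compact_continuous_image continuous_intros) auto
  then have "bdd_above ((\<lambda>x. \<bar>poly p x\<bar>) ` {0..1})"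
    by (simp add: compact_imp_bounded bounded_imp_bdd_above)
  then show ?thesis
    using assms by (auto simp: poly_norm_def intro!: cSUP_upper)
qed

text \<open>For finite \<open>r\<close> the function \<open>\<bar>P t\<bar> powr r\<close> is itself
  periodic, so its integral is \<open>N * h\<close> times the integral over one period, and equality
  holds. For \<open>r = \<infinity>\<close> only the upper bound by the maximum of
  \<open>\<bar>poly p x\<bar>\<close> is derived, hence the inequality in the statement.\<close>

lemma Lp_norm_periodic_poly:
  fixes p :: "real poly" and a h :: real and N :: nat
  defines "M \<equiv> lebesgue_on {a..a + real N * h}"
  defines "P \<equiv> \<lambda>t. poly p (frac ((t - a) / h))"
  assumes "0 < h" and "0 < N" and "1 \<le> r"
  shows "in_Lp r M P"
    and "Lp_norm r M P \<le> (real N * h) powr real_of_ereal (1 / r) * poly_norm r p"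
proof -
  define C where "C = poly_norm \<infinity> p"
  have PC: "\<bar>P t\<bar> \<le> C" for t
    unfolding P_def C_def
    by (rule abs_poly_le_poly_norm_infinity) (auto simp: frac_lt_1 less_imp_le)
  have "(\<lambda>t. poly p (frac ((t - a) / h))) \<in> borel_measurable borel"
    unfolding frac_def
    by (rule measurable_compose[OF _ borel_measurable_continuous_onI]) (auto intro!: continuous_intros)
  then have [measurable]: "P \<in> borel_measurable M"
    unfolding M_def P_def by (intro measurable_restrict_space1 measurable_completion) simp
  have Linf: "esssup M (\<lambda>t. ereal \<bar>P t\<bar>) \<le> ereal C"
    by (rule esssup_I) (auto simp: PC)
  have fin: "finite_measure M"
    by (rule finite_measureI) (simp add: M_def emeasure_restrict_space emeasure_lborel_Icc_eq)
  \<comment> \<open>A bounded measurable function on a finite measure space is integrable.\<close>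
  have powr_int: "integrable M (\<lambda>t. \<bar>P t\<bar> powr r')" if "0 \<le> r'" for r'
    by (rule finite_measure.integrable_const_bound[OF fin, where B = "C powr r'"])
      (use PC that in \<open>auto intro!: AE_I2 powr_mono2\<close>)
  have "in_Lp r M P \<and> Lp_norm r M P \<le> (real N * h) powr real_of_ereal (1 / r) * poly_norm r p"
  proof (cases r)
    case (real r')
    then have r': "1 \<le> r'" using assms(5) by (simp add: one_ereal_def)
    have int: "integrable M (\<lambda>t. \<bar>P t\<bar> powr r')" using r' powr_int by simp
    \<comment> \<open>The block formula with constant second factor 1 has \<open>N\<close> identical
      summands.\<close>
    have "(LINT t|M. \<bar>P t\<bar> powr r') = real N * h * (LINT x|lebesgue_on {0..1}. \<bar>poly p x\<bar> powr r')"
      using integral_periodic_factor[OF assms(3), where q = "\<lambda>x. \<bar>poly p x\<bar> powr r'" and G = "\<lambda>_. 1"] int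
      by (simp add: M_def P_def mult.commute)
    then have "Lp_norm r M P = (real N * h) powr (1 / r') * poly_norm r p"
      using real assms(3) by (simp add: Lp_norm_def poly_norm_def powr_mult)
    then show ?thesis
      using int r' real by (simp add: in_Lp_def one_ereal_def)
  next
    case PInf
    \<comment> \<open>\<open>0 \<le> C\<close> settles the value \<open>-\<infinity>\<close>, which
      \<open>real_of_ereal\<close> maps to 0.\<close>
    have "real_of_ereal (esssup M (\<lambda>t. ereal \<bar>P t\<bar>)) \<le> C"
      using Linf order_trans[OF abs_ge_zero PC]
      by (cases "esssup M (\<lambda>t. ereal \<bar>P t\<bar>)") auto
    \<comment> \<open>Here \<open>real_of_ereal (1 / r) = 0\<close>, and \<open>real N * h\<close>
      is positive, so the power in front is 1.\<close>
    then show ?thesis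
      using PInf Linf assms(3,4) by (auto simp: in_Lp_def Lp_norm_def C_def)
  qed (use assms(5) in auto)
  then show "in_Lp r M P"
    and "Lp_norm r M P \<le> (real N * h) powr real_of_ereal (1 / r) * poly_norm r p" by auto
qed

section \<open>The composite error as a single integral over \<open>[a, b]\<close>\<close>

theorem mainTheorem5:
  fixes n N :: nat and a b :: real and p :: "real poly" and r s :: ereal
    and f :: "real \<Rightarrow> real"
  assumes "n \<ge> 1" and "N \<ge> 1" and "a < b"
    and "degree p = n" and "lead_coeff p = 1 / fact n"
    and "1 \<le> r" and "1 \<le> s" and "1 / r + 1 / s = 1"
    and "\<forall>k < n - 1. nth_deriv_on {a..b} k f differentiable_on {a..b}"
    and "absolutely_continuous_on {a..b} (nth_deriv_on {a..b} (n - 1) f)"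
    and "in_Lp s (lebesgue_on {a..b}) (nth_deriv_on {a..b} n f)"
  shows "\<bar>composite_error n N a b p f\<bar>
           \<le> (b - a) powr (real n + real_of_ereal (1 / r)) / real N ^ n
              * poly_norm r p * Lp_norm s (lebesgue_on {a..b}) (nth_deriv_on {a..b} n f)"
proof -
  define h where "h = (b - a) / real N"
  define g where "g = nth_deriv_on {a..b} n f"
  define P where "P = (\<lambda>t. poly p (frac ((t - a) / h)))"
  define M where "M = lebesgue_on {a..b}"
  have h: "0 < h" and b: "b = a + real N * h"
    using assms(2,3) by (simp_all add: h_def)
  have P: "in_Lp r M P"
    "Lp_norm r M P \<le> (b - a) powr real_of_ereal (1 / r) * poly_norm r p"
    using Lp_norm_periodic_poly[OF h _ assms(6), of N a p] assms(2) b
    by (auto simp: M_def P_def)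
  have g: "in_Lp s M g" using assms(11) by (simp add: M_def g_def)
  note Holder = Holder_inequality[OF assms(6-8) P(1) g]
  have "(LINT t|M. P t * g t)
      = h * (\<Sum>k<N. LINT x|lebesgue_on {0..1}. poly p x * g (a + real k * h + h * x))"
    using integral_periodic_factor[OF h, of a N "poly p" g] Holder(1)
    unfolding M_def P_def b by simp
  moreover have "composite_error n N a b p f
      = (\<Sum>k<N. (-1) ^ n * h ^ (n + 1) *
          (LINT x|lebesgue_on {0..1}. poly p x * g (a + real k * h + h * x)))"
    unfolding composite_error_def error_term_def Let_def h_def[symmetric] g_def[symmetric]
    by (simp add: algebra_simps)
  \<comment> \<open>One of the \<open>n + 1\<close> factors \<open>h\<close> is absorbed by the
    block formula, which leaves \<open>h ^ n\<close>.\<close>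
  ultimately have "composite_error n N a b p f = (-1) ^ n * h ^ n * (LINT t|M. P t * g t)"
    by (simp add: sum_distrib_left algebra_simps)
  then have "\<bar>composite_error n N a b p f\<bar> = h ^ n * \<bar>LINT t|M. P t * g t\<bar>"
    using h by (simp add: abs_mult power_abs)
  also have "\<dots> \<le> h ^ n * (Lp_norm r M P * Lp_norm s M g)"
    using Holder(2) h by (intro mult_left_mono) auto
  also have "\<dots> \<le> h ^ n * ((b - a) powr real_of_ereal (1 / r) * poly_norm r p * Lp_norm s M g)"
    using P(2) h by (intro mult_left_mono mult_right_mono Lp_norm_nonneg) auto
  \<comment> \<open>\<open>h ^ n\<close> supplies both \<open>(b - a) ^ n\<close> and the
    denominator \<open>N ^ n\<close>; as \<open>b - a\<close> is positive, its natural power merges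
    with the real power \<open>1 / r\<close>.\<close>
  also have "\<dots> = (b - a) powr (real n + real_of_ereal (1 / r)) / real N ^ n * poly_norm r p * Lp_norm s M g"
    using assms(3) by (simp add: h_def power_divide powr_add powr_realpow)
  finally show ?thesis by (simp add: M_def g_def)
qed

end
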